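(* Let $X$ be a centered, nondegenerate, infinitely divisible real random variable with finite variance $V>0$, and let $\mathcal{F}$ be its set of feasible pairs. The map $v\mapsto c_*(v)$, with values in $[0,\infty]$, is nonincreasing and convex on $[V,\infty)$, and $$\mathcal{F}\cap\bigl([V,\infty)\times[0,\infty)\bigr)=\{(v,c)\in[V,\infty)\times[0,\infty):\ c\ge c_*(v)\},$$ so this part of the feasible region is convex.
   Context: Standing setting: $X$ is a centered, nondegenerate, infinitely divisible real random variable with variance $0<V=\mathrm{Var}(X)<\infty$, Gaussian variance $a\ge0$ and Lévy measure $\nu$ on $\mathbb{R}\setminus\{0\}$. For all real $t$, $K_X(t)=\log\mathbb{E}e^{tX}=\frac{at^2}{2}+\int_{\mathbb{R}\setminus\{0\}}(e^{tx}-1-tx)\,\nu(dx)\in[0,\infty]$. A pair $(v,c)\in(0,\infty)\times[0,\infty)$ is feasible for $X$ if $K_X(t)\le \frac{vt^2}{2(1-ct)}$ for every $0\le t<1/c$ (with $1/0=\infty$; for $c=0$: for all $t\ge0$). $\mathcal{F}$ is the set of feasible pairs, and $c_*(v)=\inf\{c\ge0:(v,c)\in\mathcal{F}\}\in[0,\infty]$, with $\inf\emptyset=\infty$. Convexity of the extended-valued function $c_*$ is in the usual sense of convex functions with values in $[0,\infty]$. *)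

theory Defs
  imports "HOL-Probability.Probability"
begin

text \<open>The law of \<open>X\<close> is infinitely divisible: for every \<open>n \<ge> 1\<close> it is the law of the sum of
  \<open>n\<close> independent variables with a common law \<open>\<mu>\<close>, realised as the coordinates of the product
  space.\<close>

definition infinitely_divisible :: "'a measure \<Rightarrow> ('a \<Rightarrow> real) \<Rightarrow> bool" where
  "infinitely_divisible M X \<longleftrightarrow>
     (\<forall>n::nat\<ge>1. \<exists>\<mu>. real_distribution \<mu> \<and>
        distr M borel X = distr (PiM {..<n} (\<lambda>_. \<mu>)) borel (\<lambda>x. \<Sum>i<n. x i))"

text \<open>\<open>K\<^sub>X(t) = log E e\<^bsup>tX\<^esup>\<close>. The case distinction is needed because the Bochner integral of a
  non-integrable function is \<open>0\<close>; here the expectation of a nonnegative variable is then \<open>\<infinity>\<close>.\<close>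

definition cumulant_gf :: "'a measure \<Rightarrow> ('a \<Rightarrow> real) \<Rightarrow> real \<Rightarrow> ereal" where
  "cumulant_gf M X t =
     (if integrable M (\<lambda>\<omega>. exp (t * X \<omega>))
      then ereal (ln (prob_space.expectation M (\<lambda>\<omega>. exp (t * X \<omega>))))
      else \<infinity>)"

text \<open>The bound \<open>t < 1/c\<close> is read in \<^typ>\<open>ereal\<close>, where \<open>1/0 = \<infinity>\<close>.\<close>

definition feasible :: "'a measure \<Rightarrow> ('a \<Rightarrow> real) \<Rightarrow> (real \<times> real) set" where
  "feasible M X =
     {(v, c). 0 < v \<and> 0 \<le> c \<and>
        (\<forall>t\<ge>0. ereal t < 1 / ereal c \<longrightarrow>
           cumulant_gf M X t \<le> ereal (v * t\<^sup>2 / (2 * (1 - c * t))))}"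

definition c_star :: "'a measure \<Rightarrow> ('a \<Rightarrow> real) \<Rightarrow> real \<Rightarrow> ennreal" where
  "c_star M X v = (INF c\<in>{c. 0 \<le> c \<and> (v, c) \<in> feasible M X}. ennreal c)"

text \<open>The analogue of \<^const>\<open>convex_on\<close> for values in \<open>[0,\<infinity>]\<close>. The convention \<open>0 * \<infinity> = 0\<close> of
  \<^typ>\<open>ennreal\<close> only matters at the trivial weights \<open>(0,1)\<close> and \<open>(1,0)\<close>.\<close>

definition ennreal_convex_on :: "'b::real_vector set \<Rightarrow> ('b \<Rightarrow> ennreal) \<Rightarrow> bool" where
  "ennreal_convex_on S f \<longleftrightarrow> convex S \<and>
     (\<forall>x\<in>S. \<forall>y\<in>S. \<forall>u\<ge>0. \<forall>w\<ge>0. u + w = 1 \<longrightarrow>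
        f (u *\<^sub>R x + w *\<^sub>R y) \<le> ennreal u * f x + ennreal w * f y)"

end

theory Submission
  imports Defs
begin

text \<open>
  Fix \<open>t > 0\<close>. The cumulant generating function of a centered variable is nonnegative, by
  \<open>e\<^sup>x \<ge> 1 + x\<close>. Hence the Bernstein-type bound \<open>K(t) \<le> v t\<^sup>2 / (2 (1 - c t))\<close>, required only when
  \<open>c t < 1\<close>, is one linear inequality in \<open>(v, c)\<close>: after multiplying out it reads
  \<open>2 K(t) \<le> t\<^sup>2 v + 2 t K(t) c\<close>, which is automatic when \<open>c t \<ge> 1\<close>. If \<open>K(t) = \<infinity>\<close>, the bound just
  forbids \<open>c t < 1\<close>, which is the linear inequality \<open>1 \<le> t c\<close>.

  So the feasible region is the intersection of the quadrant \<open>v > 0\<close>, \<open>c \<ge> 0\<close> with closed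
  half-planes whose normals have nonnegative entries (lemma \<open>feasible_iff_half_planes\<close>).
  Everything follows from this description: the region is convex, it is closed upwards in both
  coordinates, and its sections at fixed \<open>v\<close> are closed, so that the infimum \<open>c\<^sub>*(v)\<close> is attained as
  soon as it is finite (lemma \<open>feasible_iff_c_star_le\<close>). The region is therefore the epigraph
  of \<open>c\<^sub>*\<close> over \<open>v > 0\<close>. Upward closure in \<open>v\<close> makes \<open>c\<^sub>*\<close> nonincreasing, and convexity of the epigraph makes
  it convex.
\<close>

section \<open>Feasibility as a family of linear inequalities\<close>

lemma cumulant_gf_zero:
  assumes "prob_space M"
  shows "cumulant_gf M X 0 = 0"
proof -
  interpret prob_space M by fact
  show ?thesis by (simp add: cumulant_gf_def prob_space)
qed

lemma cumulant_gf_nonneg_if_centered: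
  assumes "prob_space M" and X: "integrable M X" and "prob_space.expectation M X = 0"
  shows "0 \<le> cumulant_gf M X t"
proof (cases "integrable M (\<lambda>\<omega>. exp (t * X \<omega>))")
  case True
  interpret prob_space M by fact
  have "1 = expectation (\<lambda>\<omega>. 1 + t * X \<omega>)"
    using X \<open>expectation X = 0\<close> by (simp add: prob_space)
  also have "\<dots> \<le> expectation (\<lambda>\<omega>. exp (t * X \<omega>))"
    using X True by (intro integral_mono) simp_all
  finally show ?thesis
    using True by (simp add: cumulant_gf_def)
next
  case False
  then show ?thesis by (simp add: cumulant_gf_def)
qed

definition half_plane_at :: "(real \<Rightarrow> ereal) \<Rightarrow> real \<Rightarrow> real \<Rightarrow> real \<Rightarrow> bool" where
  "half_plane_at K t v c \<longleftrightarrow>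
     (if K t = \<infinity> then 1 \<le> t * c
      else 2 * real_of_ereal (K t) \<le> t\<^sup>2 * v + 2 * t * real_of_ereal (K t) * c)"

text \<open>All the later arguments use only the following shape of the constraint, in which the two
  cases of the definition are merged.\<close>

lemma half_plane_at_linear:
  assumes "0 < t" and "0 \<le> K t"
  obtains \<alpha> \<beta> \<gamma> where "0 \<le> \<alpha>" "0 \<le> \<beta>"
    and "\<And>v c. half_plane_at K t v c \<longleftrightarrow> \<gamma> \<le> \<alpha> * v + \<beta> * c"
proof (cases "K t = \<infinity>")
  case True
  then show ?thesis
    using assms that[of 0 t 1] by (simp add: half_plane_at_def)
next
  case False
  then show ?thesis
    using assms that[of "t\<^sup>2" "2 * t * real_of_ereal (K t)" "2 * real_of_ereal (K t)"]
    by (simp add: half_plane_at_def real_of_ereal_pos)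
qed

lemma less_one_divide_ereal_iff:
  assumes "0 \<le> c"
  shows "ereal t < 1 / ereal c \<longleftrightarrow> c * t < 1"
proof (cases "c = 0")
  case False
  then show ?thesis
    using assms by (simp add: one_ereal_def pos_less_divide_eq mult.commute)
qed (simp add: divide_ereal_def)

text \<open>Clearing the denominator is legitimate because the bound is only required where
  \<open>1 - c t > 0\<close>; where \<open>1 - c t \<le> 0\<close>, the inequality \<open>2 (1 - c t) K(t) \<le> t\<^sup>2 v\<close> is automatic since
  \<open>K(t) \<ge> 0\<close>.\<close>

lemma bound_iff_half_plane_at:
  assumes "0 < t" "0 \<le> K t" "0 < v"
  shows "(c * t < 1 \<longrightarrow> K t \<le> ereal (v * t\<^sup>2 / (2 * (1 - c * t)))) \<longleftrightarrow> half_plane_at K t v c"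
proof (cases "K t")
  case (real k)
  have k: "0 \<le> k" using assms real by simp
  show ?thesis
  proof (cases "c * t < 1")
    case True
    then have "k \<le> v * t\<^sup>2 / (2 * (1 - c * t)) \<longleftrightarrow> k * (2 * (1 - c * t)) \<le> v * t\<^sup>2"
      by (intro pos_le_divide_eq) simp
    then show ?thesis
      using True real by (simp add: half_plane_at_def algebra_simps)
  next
    case False
    then have "(1 - c * t) * k \<le> 0"
      using k by (intro mult_nonpos_nonneg) auto
    moreover have "0 \<le> t\<^sup>2 * v" using assms by simp
    ultimately show ?thesis
      using False real by (simp add: half_plane_at_def algebra_simps)
  qed
next
  case PInf
  then show ?thesis by (auto simp: half_plane_at_def mult.commute)
next
  case MInf
  then show ?thesis using assms by simp
qed

lemma feasible_iff_half_planes: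
  assumes "cumulant_gf M X 0 = 0" and "\<And>t. 0 \<le> cumulant_gf M X t"
  shows "(v, c) \<in> feasible M X \<longleftrightarrow>
    0 < v \<and> 0 \<le> c \<and> (\<forall>t>0. half_plane_at (cumulant_gf M X) t v c)"
proof (cases "0 < v \<and> 0 \<le> c")
  case True
  have "(\<forall>t\<ge>0. c * t < 1 \<longrightarrow> cumulant_gf M X t \<le> ereal (v * t\<^sup>2 / (2 * (1 - c * t)))) \<longleftrightarrow>
    (\<forall>t>0. c * t < 1 \<longrightarrow> cumulant_gf M X t \<le> ereal (v * t\<^sup>2 / (2 * (1 - c * t))))"
    using assms(1) by (auto simp: le_less)
  also have "\<dots> \<longleftrightarrow> (\<forall>t>0. half_plane_at (cumulant_gf M X) t v c)"
    using True bound_iff_half_plane_at[where K = "cumulant_gf M X", OF _ assms(2)] by blast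
  finally show ?thesis
    using True by (simp add: feasible_def less_one_divide_ereal_iff)
qed (auto simp: feasible_def)

section \<open>Geometry of the feasible region\<close>

lemma feasible_upward_closed:
  assumes K: "cumulant_gf M X 0 = 0" "\<And>t. 0 \<le> cumulant_gf M X t"
    and vc: "(v, c) \<in> feasible M X" "v \<le> v'" "c \<le> c'"
  shows "(v', c') \<in> feasible M X"
proof -
  have "half_plane_at (cumulant_gf M X) t v' c'" if t: "0 < t" for t
  proof -
    obtain \<alpha> \<beta> \<gamma> where "0 \<le> \<alpha>" "0 \<le> \<beta>"
      and h: "\<And>v c. half_plane_at (cumulant_gf M X) t v c \<longleftrightarrow> \<gamma> \<le> \<alpha> * v + \<beta> * c"
      using half_plane_at_linear[where K = "cumulant_gf M X", OF t K(2)] by blast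
    then have "\<alpha> * v + \<beta> * c \<le> \<alpha> * v' + \<beta> * c'"
      using vc by (intro add_mono mult_left_mono)
    then show ?thesis
      using vc t h K by (force simp: feasible_iff_half_planes)
  qed
  then show ?thesis
    using vc K by (auto simp: feasible_iff_half_planes)
qed

lemma convex_feasible:
  assumes K: "cumulant_gf M X 0 = 0" "\<And>t. 0 \<le> cumulant_gf M X t"
  shows "convex (feasible M X)"
proof -
  let ?H = "\<lambda>t. {(v, c). half_plane_at (cumulant_gf M X) t v c}"
  have "convex (?H t)" if t: "0 < t" for t
  proof -
    obtain \<alpha> \<beta> \<gamma> where "0 \<le> \<alpha>" "0 \<le> \<beta>"
      and h: "\<And>v c. half_plane_at (cumulant_gf M X) t v c \<longleftrightarrow> \<gamma> \<le> \<alpha> * v + \<beta> * c"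
      using half_plane_at_linear[where K = "cumulant_gf M X", OF t K(2)] by blast
    have "?H t = {p. inner (\<alpha>, \<beta>) p \<ge> \<gamma>}"
      by (auto simp: inner_prod_def h)
    then show ?thesis
      by (simp add: convex_halfspace_ge)
  qed
  then have "convex (({0<..} \<times> {0..}) \<inter> (\<Inter>t\<in>{0<..}. ?H t))"
    by (intro convex_Int convex_Times convex_INT) auto
  moreover have "feasible M X = ({0<..} \<times> {0..}) \<inter> (\<Inter>t\<in>{0<..}. ?H t)"
    using K by (auto simp: feasible_iff_half_planes)
  ultimately show ?thesis by simp
qed

text \<open>Attainment of the infimum. By upward closure, \<open>c\<^sub>*(v) \<le> c\<close> makes every \<open>(v, c + \<epsilon>)\<close> feasible;
  each half-plane is closed, so \<open>\<epsilon> \<rightarrow> 0\<close> preserves membership.\<close>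

lemma feasible_iff_c_star_le:
  assumes K: "cumulant_gf M X 0 = 0" "\<And>t. 0 \<le> cumulant_gf M X t"
    and v: "0 < v" and c: "0 \<le> c"
  shows "(v, c) \<in> feasible M X \<longleftrightarrow> c_star M X v \<le> ennreal c"
proof
  assume "(v, c) \<in> feasible M X"
  then show "c_star M X v \<le> ennreal c"
    unfolding c_star_def using c by (intro INF_lower) simp
next
  assume le: "c_star M X v \<le> ennreal c"
  have above: "(v, c + \<epsilon>) \<in> feasible M X" if "0 < \<epsilon>" for \<epsilon>
  proof -
    have "c_star M X v < ennreal (c + \<epsilon>)"
      using le that c by (simp add: ennreal_less_iff le_less_trans)
    then obtain d where "0 \<le> d" "(v, d) \<in> feasible M X" "ennreal d < ennreal (c + \<epsilon>)"
      unfolding c_star_def by (auto simp: INF_less_iff)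
    then show ?thesis
      using feasible_upward_closed[OF K, of v d v "c + \<epsilon>"] by (simp add: ennreal_less_iff)
  qed
  have "half_plane_at (cumulant_gf M X) t v c" if t: "0 < t" for t
  proof -
    obtain \<alpha> \<beta> \<gamma> where "0 \<le> \<alpha>" "0 \<le> \<beta>"
      and h: "\<And>v c. half_plane_at (cumulant_gf M X) t v c \<longleftrightarrow> \<gamma> \<le> \<alpha> * v + \<beta> * c"
      using half_plane_at_linear[where K = "cumulant_gf M X", OF t K(2)] by blast
    have "((\<lambda>\<epsilon>. \<alpha> * v + \<beta> * (c + \<epsilon>)) \<longlongrightarrow> \<alpha> * v + \<beta> * (c + 0)) (at_right 0)"
      by (intro tendsto_intros)
    moreover have "\<gamma> \<le> \<alpha> * v + \<beta> * (c + \<epsilon>)" if "0 < \<epsilon>" for \<epsilon>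
      unfolding h[symmetric] using above[OF that] t feasible_iff_half_planes[OF K] by blast
    then have "\<forall>\<^sub>F \<epsilon> in at_right 0. \<gamma> \<le> \<alpha> * v + \<beta> * (c + \<epsilon>)"
      by (rule eventually_mono[OF eventually_at_right_less])
    ultimately have "\<gamma> \<le> \<alpha> * v + \<beta> * (c + 0)"
      by (rule tendsto_lowerbound) simp
    then show ?thesis by (simp add: h)
  qed
  then show "(v, c) \<in> feasible M X"
    using v c K by (simp add: feasible_iff_half_planes)
qed

section \<open>The boundary function\<close>

lemma c_star_antimono:
  assumes K: "cumulant_gf M X 0 = 0" "\<And>t. 0 \<le> cumulant_gf M X t" and "v \<le> w"
  shows "c_star M X w \<le> c_star M X v"
  unfolding c_star_def
  by (rule INF_superset_mono) (auto intro: feasible_upward_closed[OF K _ \<open>v \<le> w\<close> order_refl])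

text \<open>The pairs \<open>(v, c\<^sub>*(v))\<close> with \<open>c\<^sub>*(v) < \<infinity>\<close> lie in the convex feasible region, so the chord
  between two of them does too. If one endpoint value is infinite and its weight is positive, the
  right-hand side is infinite; a zero weight leaves only the other endpoint.\<close>

lemma ennreal_convex_on_c_star:
  assumes K: "cumulant_gf M X 0 = 0" "\<And>t. 0 \<le> cumulant_gf M X t"
    and S: "convex S" "S \<subseteq> {0<..}"
  shows "ennreal_convex_on S (c_star M X)"
  unfolding ennreal_convex_on_def
proof (intro conjI ballI allI impI)
  fix x y u w :: real
  assume xy: "x \<in> S" "y \<in> S" and uw: "0 \<le> u" "0 \<le> w" "u + w = 1"
  let ?f = "c_star M X"
  consider "u = 0" | "w = 0" | "0 < u" "0 < w" using uw by linarith
  then show "?f (u *\<^sub>R x + w *\<^sub>R y) \<le> ennreal u * ?f x + ennreal w * ?f y"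
  proof cases
    case 3
    show ?thesis
    proof (cases "?f x = \<infinity> \<or> ?f y = \<infinity>")
      case True
      then have "ennreal u * ?f x + ennreal w * ?f y = \<infinity>"
        using 3 by (auto simp: ennreal_mult_top)
      then show ?thesis by (simp only: infinity_ennreal_def top_greatest)
    next
      case False
      then obtain a b where a: "0 \<le> a" "?f x = ennreal a" and b: "0 \<le> b" "?f y = ennreal b"
        by (cases "?f x"; cases "?f y") auto
      have pos: "0 < x" "0 < y" using xy S by auto
      have "(x, a) \<in> feasible M X" "(y, b) \<in> feasible M X"
        using pos a b by (simp_all add: feasible_iff_c_star_le[OF K])
      then have "u *\<^sub>R (x, a) + w *\<^sub>R (y, b) \<in> feasible M X"
        using convex_feasible[OF K] uw by (intro convexD)
      then have chord: "(u * x + w * y, u * a + w * b) \<in> feasible M X" by simp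
      have "0 < u * x + w * y" using pos 3 by (simp add: add_pos_pos)
      then have "?f (u * x + w * y) \<le> ennreal (u * a + w * b)"
        using chord a b uw feasible_iff_c_star_le[OF K] by simp
      also have "\<dots> = ennreal u * ?f x + ennreal w * ?f y"
        using a b uw by (simp add: ennreal_mult)
      finally show ?thesis by simp
    qed
  qed (use uw in auto)
qed (rule S)

theorem theorem3p5:
  fixes M :: "'a measure" and X :: "'a \<Rightarrow> real" and V :: real
  assumes "prob_space M"
    and "X \<in> borel_measurable M"
    and "infinitely_divisible M X"
    and "\<not> (\<exists>x. AE \<omega> in M. X \<omega> = x)"
    and "integrable M (\<lambda>\<omega>. (X \<omega>)\<^sup>2)"
    and "prob_space.expectation M X = 0"
    and "V = prob_space.variance M X"
    and "0 < V"
  shows "antimono_on {V..} (c_star M X) \<and>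
    ennreal_convex_on {V..} (c_star M X) \<and>
    feasible M X \<inter> ({V..} \<times> {0..}) = {(v, c). V \<le> v \<and> 0 \<le> c \<and> c_star M X v \<le> ennreal c} \<and>
    convex (feasible M X \<inter> ({V..} \<times> {0..}))"
proof -
  interpret prob_space M by fact
  have "integrable M X"
    using assms(2,5) by (rule square_integrable_imp_integrable)
  then have K: "cumulant_gf M X 0 = 0" "\<And>t. 0 \<le> cumulant_gf M X t"
    using assms(1,6) by (simp_all add: cumulant_gf_zero cumulant_gf_nonneg_if_centered)
  show ?thesis
  proof (intro conjI)
    show "antimono_on {V..} (c_star M X)"
      by (auto simp: monotone_on_def c_star_antimono[OF K])
    show "ennreal_convex_on {V..} (c_star M X)"
      using \<open>0 < V\<close> by (intro ennreal_convex_on_c_star[OF K]) auto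
    show "feasible M X \<inter> ({V..} \<times> {0..}) = {(v, c). V \<le> v \<and> 0 \<le> c \<and> c_star M X v \<le> ennreal c}"
      using \<open>0 < V\<close> by (auto simp: feasible_iff_c_star_le[OF K])
    show "convex (feasible M X \<inter> ({V..} \<times> {0..}))"
      by (intro convex_Int convex_feasible[OF K] convex_Times) auto
  qed
qed

end
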